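(* Let $f:\{-1,1\}^n\to\{-1,1\}$ be a symmetric function with predicate $D_f:\{0,1,\dots,n\}\to\{-1,1\}$, suppose the odd-even degree of $f$ equals $k$, and suppose $n$ is even. Then $\mathsf{PP}(f\circ\mathsf{XOR})=O(k\log n)$.
   Context: $D_f(i)$ is the value of $f$ on inputs with exactly $i$ coordinates equal to $-1$; the odd-even degree is $|\{i\in\{0,\dots,n-2\}:D_f(i)\ne D_f(i+2)\}|$. $(f\circ\mathsf{XOR})(x,y)=f(x_1y_1,\dots,x_ny_n)$ for $x,y\in\{-1,1\}^n$, Alice holding $x$ and Bob $y$. $R_\epsilon(G)$ is the minimum cost of a private-coin randomized protocol correct with probability $\ge1/2+\epsilon$ on every input, and $\mathsf{PP}(G)=\min_{\epsilon>0}(R_\epsilon(G)+\log(1/\epsilon))$.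
   Formalization: The bound is proved as O(max(1,k) log n) for even n > 0: for k = 0 (e.g. constant f) the literal bound O(k log n) would be 0, while PP is always at least 1; for k ≥ 1 it is exactly O(k log n). *)

theory Defs
  imports "HOL-Probability.Probability_Mass_Function" "HOL-Combinatorics.Permutations"
begin

section \<open>Symmetric functions on the sign cube\<close>

definition cube :: "nat \<Rightarrow> int list set" where
  "cube n = {x. length x = n \<and> set x \<subseteq> {-1, 1}}"

definition symmetric :: "nat \<Rightarrow> (int list \<Rightarrow> int) \<Rightarrow> bool" where
  "symmetric n f \<longleftrightarrow>
     (\<forall>x\<in>cube n. \<forall>\<sigma>. \<sigma> permutes {..<n} \<longrightarrow> f (permute_list \<sigma> x) = f x)"

text \<open>For symmetric \<open>f\<close> and \<open>i \<le> n\<close> the value below exists and is unique, see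
  \<open>predicate_count\<close>; only these \<open>i\<close> are ever used.\<close>

definition predicate :: "nat \<Rightarrow> (int list \<Rightarrow> int) \<Rightarrow> nat \<Rightarrow> int" where
  "predicate n f i = (THE v. \<forall>x\<in>cube n. count_list x (-1) = i \<longrightarrow> f x = v)"

text \<open>The side condition \<open>i + 2 \<le> n\<close> is \<open>i \<in> {0..n-2}\<close> without truncated subtraction.\<close>

definition odd_even_degree :: "nat \<Rightarrow> (int list \<Rightarrow> int) \<Rightarrow> nat" where
  "odd_even_degree n f = card {i. i + 2 \<le> n \<and> predicate n f i \<noteq> predicate n f (i + 2)}"

definition comp_XOR :: "(int list \<Rightarrow> int) \<Rightarrow> int list \<Rightarrow> int list \<Rightarrow> int" where
  "comp_XOR f x y = f (map2 (*) x y)"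

lemma cube_mset_eq:
  assumes "x \<in> cube n" "y \<in> cube n" "count_list x (-1) = count_list y (-1)"
  shows "mset x = mset y"
proof -
  have dec: "mset z = replicate_mset (count_list z (-1)) (-1)
      + replicate_mset (length z - count_list z (-1)) 1 \<and> count_list z (-1) \<le> length z"
    if "set z \<subseteq> {-1, 1}" for z :: "int list"
    using that
  proof (induction z)
    case (Cons a z)
    then show ?case by (cases "a = -1") (simp_all add: Suc_diff_le)
  qed simp
  have "set x \<subseteq> {-1, 1}" "set y \<subseteq> {-1, 1}" "length x = length y"
    using assms by (simp_all add: cube_def)
  then show ?thesis
    using dec[of x, THEN conjunct1] dec[of y, THEN conjunct1] assms(3) by simp
qed

lemma predicate_count:
  assumes "symmetric n f" "x \<in> cube n"
  shows "predicate n f (count_list x (-1)) = f x"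
proof -
  have "f y = f x" if y: "y \<in> cube n" "count_list y (-1) = count_list x (-1)" for y
  proof -
    have "mset y = mset x" using cube_mset_eq y assms(2) by blast
    then obtain \<sigma> where "\<sigma> permutes {..<length x}" "permute_list \<sigma> x = y"
      by (rule mset_eq_permutation)
    moreover have "length x = n" using assms(2) by (simp add: cube_def)
    ultimately show ?thesis using assms by (metis symmetric_def)
  qed
  then show ?thesis
    unfolding predicate_def using assms(2) by (intro the_equality) blast+
qed


section \<open>Private-coin randomized communication complexity\<close>

text \<open>A protocol tree. At an inner node the indicated player sends one bit, which is a
  function of everything that player sees; the transcript determines the output.\<close>

datatype ('a, 'b, 'o) protocol =
    Output 'o
  | Alice "'a \<Rightarrow> bool" "('a, 'b, 'o) protocol" "('a, 'b, 'o) protocol"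
  | Bob "'b \<Rightarrow> bool" "('a, 'b, 'o) protocol" "('a, 'b, 'o) protocol"

primrec run :: "('a, 'b, 'o) protocol \<Rightarrow> 'a \<Rightarrow> 'b \<Rightarrow> 'o" where
  "run (Output v) a b = v"
| "run (Alice g P Q) a b = (if g a then run P a b else run Q a b)"
| "run (Bob g P Q) a b = (if g b then run P a b else run Q a b)"

primrec cost :: "('a, 'b, 'o) protocol \<Rightarrow> nat" where
  "cost (Output v) = 0"
| "cost (Alice g P Q) = Suc (max (cost P) (cost Q))"
| "cost (Bob g P Q) = Suc (max (cost P) (cost Q))"

text \<open>In a private-coin protocol Alice sees \<open>(x, r)\<close> and Bob sees \<open>(y, s)\<close>, where the
  random strings \<open>r\<close> and \<open>s\<close> are drawn independently from distributions \<open>\<mu>\<close> and \<open>\<nu>\<close>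
  that belong to the protocol and do not depend on the input.\<close>

type_synonym coins = "bool list"

definition success_prob ::
    "('x \<times> coins, 'y \<times> coins, 'o) protocol \<Rightarrow> coins pmf \<Rightarrow> coins pmf
     \<Rightarrow> ('x \<Rightarrow> 'y \<Rightarrow> 'o) \<Rightarrow> 'x \<Rightarrow> 'y \<Rightarrow> real" where
  "success_prob P \<mu> \<nu> G x y =
     measure_pmf.prob (pair_pmf \<mu> \<nu>) {(r, s). run P (x, r) (y, s) = G x y}"

text \<open>Extended values make an infeasible \<open>\<epsilon>\<close> (that is, \<open>\<epsilon> > 1/2\<close>) have complexity \<open>\<infinity>\<close>.\<close>

definition rand_complexity ::
    "real \<Rightarrow> 'x set \<Rightarrow> 'y set \<Rightarrow> ('x \<Rightarrow> 'y \<Rightarrow> 'o) \<Rightarrow> enat" where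
  "rand_complexity \<epsilon> X Y G =
     Inf {enat (cost P) | (P :: ('x \<times> coins, 'y \<times> coins, 'o) protocol) \<mu> \<nu>.
            \<forall>x\<in>X. \<forall>y\<in>Y. success_prob P \<mu> \<nu> G x y \<ge> 1/2 + \<epsilon>}"

definition PP :: "'x set \<Rightarrow> 'y set \<Rightarrow> ('x \<Rightarrow> 'y \<Rightarrow> 'o) \<Rightarrow> ereal" where
  "PP X Y G =
     (INF \<epsilon>\<in>{0<..}. ereal_of_enat (rand_complexity \<epsilon> X Y G) + ereal (log 2 (1 / \<epsilon>)))"

end

theory Submission
  imports Defs
begin

text \<open>Let \<open>c\<close> be the Hamming distance of \<open>x\<close> and \<open>y\<close>, so that the value to be computed is
  \<open>D c\<close>. Among the \<open>c\<close> of a fixed parity, \<open>D\<close> agrees up to a constant sign with the product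
  of the factors \<open>c - (i + 1)\<close> over the jumps \<open>i\<close> of that parity, and no factor vanishes.
  Each \<open>(c - (i + 1)) / n\<close> is the expectation of a random sign that is a function of a random
  index \<open>m < 2 n\<close>, of \<open>x\<^sub>m\<close> and of \<open>y\<^sub>m\<close>. Multiplying independent such signs gives a sign that is
  correct with bias at least \<open>1 / n ^ k\<close>, and it costs Alice \<open>O(log n)\<close> bits per jump.\<close>

section \<open>Counting and sums\<close>

text \<open>A product entry is -1 exactly when one of its two factors is, so the three counts add up
  to an even number. One bit from Alice therefore tells Bob the parity of the distance.\<close>

lemma even_count_list_map2_times:
  assumes "length x = length y" "set x \<subseteq> {-1, 1::int}" "set y \<subseteq> {-1, 1}"
  shows "even (count_list (map2 (*) x y) (-1)) \<longleftrightarrow>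
    (even (count_list x (-1)) \<longleftrightarrow> even (count_list y (-1)))"
  using assms by (induction x y rule: list_induct2) auto

lemma sum_list_signs:
  assumes "set z \<subseteq> {-1, 1::int}"
  shows "sum_list z = int (length z) - 2 * int (count_list z (-1))"
  using assms by (induction z) auto

lemma map2_times_cube:
  assumes "x \<in> cube n" "y \<in> cube n"
  shows "map2 (*) x y \<in> cube n"
proof -
  have "length x = length y" "set x \<subseteq> {-1, 1}" "set y \<subseteq> {-1, 1}"
    using assms by (simp_all add: cube_def)
  then have "set (map2 (*) x y) \<subseteq> {-1, 1}"
    by (induction x y rule: list_induct2) auto
  then show ?thesis using assms by (simp add: cube_def)
qed

text \<open>Distributivity: expanding the product picks one index \<open>m\<close> per factor. In
  probabilistic terms, independent indices make the expectation of the product equal the product of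
  the expectations.\<close>

lemma sum_lists_prod_list:
  fixes g :: "'a \<Rightarrow> 'b \<Rightarrow> 'c::comm_semiring_1"
  assumes "finite A"
  shows "(\<Sum>ms | set ms \<subseteq> A \<and> length ms = length ts. prod_list (map2 g ts ms)) =
    (\<Prod>t\<leftarrow>ts. \<Sum>m\<in>A. g t m)"
proof (induction ts)
  case Nil
  have "{ms. set ms \<subseteq> A \<and> length ms = length ([]::'a list)} = {[]}" by auto
  then show ?case by simp
next
  case (Cons t ts)
  let ?S = "{ms. set ms \<subseteq> A \<and> length ms = length ts}"
  have eq: "{ms. set ms \<subseteq> A \<and> length ms = length (t # ts)} = (\<lambda>(m, ms). m # ms) ` (A \<times> ?S)"
    by (auto simp: length_Suc_conv image_iff)
  have "inj_on (\<lambda>(m, ms). m # ms) (A \<times> ?S)" by (auto simp: inj_on_def)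
  then have "(\<Sum>ms | set ms \<subseteq> A \<and> length ms = length (t # ts). prod_list (map2 g (t # ts) ms))
      = (\<Sum>(m, ms)\<in>A \<times> ?S. g t m * prod_list (map2 g ts ms))"
    unfolding eq by (simp add: sum.reindex case_prod_unfold)
  also have "\<dots> = (\<Sum>m\<in>A. g t m) * (\<Sum>ms\<in>?S. prod_list (map2 g ts ms))"
    by (simp add: sum_product sum.cartesian_product)
  finally show ?case using Cons.IH by simp
qed

text \<open>\<open>v * V s\<close> is 1 on agreement and -1 otherwise. This turns the correlation of
  a random sign with the target into a success count.\<close>

lemma card_agree_signs:
  fixes V :: "'a \<Rightarrow> int"
  assumes "finite S" "V \<in> S \<rightarrow> {-1, 1}" "v \<in> {-1, 1}"
  shows "2 * int (card {s\<in>S. V s = v}) = int (card S) + v * (\<Sum>s\<in>S. V s)"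
proof -
  have "v * (\<Sum>s\<in>S. V s) = (\<Sum>s\<in>S. 2 * of_bool (V s = v) - 1)"
    unfolding sum_distrib_left using assms by (intro sum.cong) auto
  also have "\<dots> = 2 * int (card {s\<in>S. V s = v}) - int (card S)"
    using assms(1)
    by (simp add: sum_subtractf flip: sum_distrib_left) (simp add: Collect_conj_eq)
  finally show ?thesis by simp
qed

section \<open>The random sign\<close>

text \<open>The random sign for the threshold \<open>t\<close>, at the index
  \<open>m < 2 * n\<close> and the entry \<open>z\<close> found there. The flag \<open>e\<close>
  says whether the threshold matters for the parity at hand. Indices from \<open>n\<close> on ignore
  \<open>z\<close> and only shift the mean by a constant.\<close>

definition vote :: "nat \<Rightarrow> nat \<Rightarrow> bool \<Rightarrow> nat \<Rightarrow> int \<Rightarrow> int" where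
  "vote n t e m z = (if e then if m < n then - z else if m < 2 * n - t then 1 else -1 else 1)"

lemma vote_sign:
  assumes "z \<in> cube n"
  shows "vote n t e m (z ! m) \<in> {-1, 1}"
proof -
  have "z ! m \<in> {-1, 1}" if "m < n"
    using assms that nth_mem[of m z] unfolding cube_def by blast
  then show ?thesis by (auto simp: vote_def)
qed

text \<open>If \<open>c\<close> is the number of entries -1, the three blocks of indices contribute
  \<open>2 * c - n\<close>, \<open>n - t\<close> and \<open>- t\<close>.\<close>

lemma sum_vote:
  assumes "z \<in> cube n" "t \<le> n"
  shows "(\<Sum>m<2 * n. vote n t e m (z ! m)) =
    (if e then 2 * (int (count_list z (-1)) - int t) else 2 * int n)"
proof (cases e)
  case True
  have len: "length z = n" and z: "set z \<subseteq> {-1, 1}" using assms(1) by (auto simp: cube_def)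
  have split: "{..<2 * n} = {..<n} \<union> {n..<2 * n - t} \<union> {2 * n - t..<2 * n}"
    using assms(2) by auto
  have "(\<Sum>m<2 * n. vote n t True m (z ! m)) = (\<Sum>m<n. vote n t True m (z ! m))
      + (\<Sum>m=n..<2 * n - t. vote n t True m (z ! m))
      + (\<Sum>m=2 * n - t..<2 * n. vote n t True m (z ! m))"
    unfolding split using assms(2)
    by (subst sum.union_disjoint, simp, simp, force)+ simp
  also have "(\<Sum>m<n. vote n t True m (z ! m)) = - sum_list z"
    by (simp add: vote_def sum_negf sum_list_sum_nth len atLeast0LessThan)
  also have "(\<Sum>m=n..<2 * n - t. vote n t True m (z ! m)) = (\<Sum>m=n..<2 * n - t. 1)"
    by (intro sum.cong) (auto simp: vote_def)
  also have "(\<Sum>m=2 * n - t..<2 * n. vote n t True m (z ! m)) = (\<Sum>m=2 * n - t..<2 * n. -1)"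
    using assms(2) by (intro sum.cong) (auto simp: vote_def)
  finally show ?thesis
    using True assms(2) by (simp add: sum_list_signs[OF z] len of_nat_diff)
qed (simp add: vote_def)

section \<open>Sign representation on each parity class\<close>

text \<open>The sum of the votes with threshold \<open>Suc i\<close>, the midpoint of the jump from
  \<open>i\<close> to \<open>i + 2\<close>. A jump of the other parity gets a positive constant,
  which leaves the sign of the product alone.\<close>

definition factor :: "nat \<Rightarrow> nat \<Rightarrow> nat \<Rightarrow> int" where
  "factor n i c = (if even (i + c) then 2 * (int c - int (Suc i)) else 2 * int n)"

lemma abs_factor_ge:
  assumes "n > 0"
  shows "2 \<le> \<bar>factor n i c\<bar>"
proof -
  have "c \<noteq> Suc i" if "even (i + c)" using that by auto
  then have "int c - int (Suc i) \<noteq> 0" if "even (i + c)" using that by linarith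
  then show ?thesis using assms by (auto simp: factor_def)
qed

text \<open>The step from \<open>c\<close> to \<open>c + 2\<close> passes only the midpoint
  \<open>c + 1\<close>, which is the zero of the linear factor for \<open>i = c\<close>.\<close>

lemma sgn_factor_add_2:
  "sgn (factor n i (c + 2)) = (if i = c then -1 else 1) * sgn (factor n i c)"
proof (cases "even (i + c)")
  case True
  then have "i \<noteq> Suc c" "Suc i \<noteq> c" by auto
  then consider "i = c" | "i + 2 \<le> c" | "c + 2 \<le> i" by linarith
  then show ?thesis using True by cases (simp_all add: factor_def sgn_if)
qed (auto simp: factor_def)

definition parity_sign :: "nat \<Rightarrow> nat set \<Rightarrow> (nat \<Rightarrow> int) \<Rightarrow> nat \<Rightarrow> int" where
  "parity_sign n I D c = D c * (\<Prod>i\<in>I. sgn (factor n i c))"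

text \<open>A step from \<open>b\<close> to \<open>b + 2\<close> changes the sign of
  \<open>D\<close> exactly when \<open>b \<in> I\<close>, and then exactly one factor changes sign
  too. The product is thus constant on each parity class.\<close>

lemma parity_sign_mod_2:
  assumes D: "\<And>i. i \<le> n \<Longrightarrow> D i \<in> {-1, 1}"
    and I: "I = {i. i + 2 \<le> n \<and> D i \<noteq> D (i + 2)}" and "c \<le> n"
  shows "parity_sign n I D c = parity_sign n I D (c mod 2)"
  using \<open>c \<le> n\<close>
proof (induction c rule: less_induct)
  case (less c)
  show ?case
  proof (cases "c < 2")
    case False
    then obtain b where c: "c = b + 2" by (metis add.commute le_Suc_ex not_less)
    have fin: "finite I" unfolding I by (rule finite_subset[of _ "{..n}"]) auto
    have "D (b + 2) * (if b \<in> I then -1 else 1) = D b"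
      using D[of b] D[of "b + 2"] less.prems c unfolding I by auto
    then have "parity_sign n I D c = parity_sign n I D b"
      unfolding parity_sign_def c sgn_factor_add_2 prod.distrib
      using fin by (simp add: mult.assoc[symmetric])
    then show ?thesis using less.IH[of b] less.prems c by simp
  qed simp
qed

section \<open>One-way protocols\<close>

text \<open>Alice sends \<open>L\<close> bits, least significant first. The additional bit is Bob's:
  he evaluates \<open>h\<close> and announces the result, since the transcript has to determine the
  output.\<close>

lemma send_number:
  fixes a :: "'x \<Rightarrow> nat" and u v :: 'o
  shows "\<exists>P :: ('x, 'y, 'o) protocol. cost P \<le> Suc L \<and>
    (\<forall>x y. a x < 2 ^ L \<longrightarrow> run P x y = (if h (a x) y then u else v))"
proof (induction L arbitrary: a h)
  case 0
  show ?case by (rule exI[of _ "Bob (h 0) (Output u) (Output v)"]) simp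
next
  case (Suc L)
  obtain P0 :: "('x, 'y, 'o) protocol" where P0: "cost P0 \<le> Suc L"
    "\<And>x y. a x div 2 < 2 ^ L \<Longrightarrow> run P0 x y = (if h (2 * (a x div 2)) y then u else v)"
    \<comment> \<open>The number still to be sent is the half; the changed \<open>h\<close> restores
      the bit already known.\<close>
    using Suc[of "\<lambda>x. a x div 2" "\<lambda>m. h (2 * m)"] by blast
  obtain P1 :: "('x, 'y, 'o) protocol" where P1: "cost P1 \<le> Suc L"
    "\<And>x y. a x div 2 < 2 ^ L \<Longrightarrow> run P1 x y = (if h (2 * (a x div 2) + 1) y then u else v)"
    using Suc[of "\<lambda>x. a x div 2" "\<lambda>m. h (2 * m + 1)"] by blast
  have "a x div 2 < 2 ^ L" if "a x < 2 ^ Suc L" for x using that by auto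
  then show ?case
    using P0 P1 by (intro exI[of _ "Alice (\<lambda>x. even (a x)) P0 P1"]) auto
qed

lemma send_message:
  fixes a :: "'x \<Rightarrow> 'm" and u v :: 'o
  assumes "finite M" "card M \<le> 2 ^ L"
  obtains P :: "('x, 'y, 'o) protocol" where "cost P \<le> Suc L"
    "\<And>x y. a x \<in> M \<Longrightarrow> run P x y = (if h (a x) y then u else v)"
proof -
  obtain e where e: "bij_betw e M {0..<card M}"
    using ex_bij_betw_finite_nat[OF assms(1)] by blast
  obtain P :: "('x, 'y, 'o) protocol" where P: "cost P \<le> Suc L"
    "\<And>x y. e (a x) < 2 ^ L \<Longrightarrow> run P x y = (if h (inv_into M e (e (a x))) y then u else v)"
    using send_number[of L "\<lambda>x. e (a x)" "\<lambda>m. h (inv_into M e m)" u v] by blast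
  have "run P x y = (if h (a x) y then u else v)" if "a x \<in> M" for x y
  proof -
    have "e (a x) < card M" using bij_betwE[OF e] that by auto
    moreover have "inv_into M e (e (a x)) = a x"
      using e that by (simp add: bij_betw_def)
    ultimately show ?thesis using P(2)[of x y] assms(2) by auto
  qed
  with P(1) that show thesis by blast
qed

text \<open>Coins are bit strings of any length, so their length can code an element of any
  countable type.\<close>

lemma rand_complexity_one_way:
  fixes msg :: "'x \<Rightarrow> 'c::countable \<Rightarrow> 'm" and G :: "'x \<Rightarrow> 'y \<Rightarrow> int"
  assumes S: "finite S" "S \<noteq> {}" and M: "finite M" "card M \<le> 2 ^ L"
    and msg: "\<And>x s. x \<in> X \<Longrightarrow> s \<in> S \<Longrightarrow> msg x s \<in> M"
    and V: "\<And>x y s. x \<in> X \<Longrightarrow> y \<in> Y \<Longrightarrow> s \<in> S \<Longrightarrow> V (msg x s) y \<in> {-1, 1}"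
    and bias: "\<And>x y. x \<in> X \<Longrightarrow> y \<in> Y \<Longrightarrow>
      real (card {s\<in>S. V (msg x s) y = G x y}) \<ge> (1/2 + \<epsilon>) * real (card S)"
  shows "rand_complexity \<epsilon> X Y G \<le> enat (Suc L)"
proof -
  define \<mu> :: "coins pmf" where
    "\<mu> = map_pmf (\<lambda>s. replicate (to_nat s) True) (pmf_of_set S)"
  \<comment> \<open>Bob needs no randomness: Alice's message carries all he has to know about her
    sample.\<close>
  define \<nu> :: "coins pmf" where "\<nu> = return_pmf []"
  obtain P :: "('x \<times> coins, 'y \<times> coins, int) protocol" where P: "cost P \<le> Suc L"
    "\<And>x y. msg (fst x) (from_nat (length (snd x))) \<in> M \<Longrightarrow> run P x y =
      (if V (msg (fst x) (from_nat (length (snd x)))) (fst y) = 1 then 1 else -1)"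
    using send_message[OF M, where a = "\<lambda>x. msg (fst x) (from_nat (length (snd x)))"
        and h = "\<lambda>m y. V m (fst y) = 1" and u = 1 and v = "-1"] by blast
  have "success_prob P \<mu> \<nu> G x y \<ge> 1/2 + \<epsilon>" if xy: "x \<in> X" "y \<in> Y" for x y
  proof -
    let ?pair = "\<lambda>s. (replicate (to_nat s) True, [] :: coins)"
    have run: "run P (x, replicate (to_nat s) True) (y, []) = V (msg x s) y" if "s \<in> S" for s
      using P(2)[of "(x, replicate (to_nat s) True)" "(y, [])"] msg[OF xy(1) that] V[OF xy that]
      by auto
    have "pair_pmf \<mu> \<nu> = map_pmf ?pair (pmf_of_set S)"
      by (simp add: \<mu>_def \<nu>_def pair_return_pmf2 pmf.map_comp o_def)
    then have "success_prob P \<mu> \<nu> G x y =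
        real (card (S \<inter> {s. run P (x, replicate (to_nat s) True) (y, []) = G x y})) / real (card S)"
      using S by (simp add: success_prob_def vimage_def measure_pmf_of_set)
    also have "S \<inter> {s. run P (x, replicate (to_nat s) True) (y, []) = G x y} =
        {s\<in>S. V (msg x s) y = G x y}"
      using run by auto
    finally have "success_prob P \<mu> \<nu> G x y =
        real (card {s\<in>S. V (msg x s) y = G x y}) / real (card S)" .
    moreover have "real (card S) > 0" using S by (simp add: card_gt_0_iff)
    ultimately show ?thesis using bias[OF xy] by (simp add: pos_le_divide_eq)
  qed
  then have "rand_complexity \<epsilon> X Y G \<le> enat (cost P)"
    unfolding rand_complexity_def by (intro Inf_lower) blast
  then show ?thesis using P(1) by (meson enat_ord_simps(1) order_trans)
qed

section \<open>The protocol\<close>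

lemma predicate_sign:
  assumes "symmetric n f" "f \<in> cube n \<rightarrow> {-1, 1}" "i \<le> n"
  shows "predicate n f i \<in> {-1, 1}"
proof -
  define x :: "int list" where "x = replicate i (-1) @ replicate (n - i) 1"
  have rep: "count_list (replicate m a) b = (if a = b then m else 0)" for m and a b :: int
    by (induction m) auto
  have "x \<in> cube n" "count_list x (-1) = i"
    using assms(3) by (auto simp: x_def cube_def rep)
  then show ?thesis using predicate_count[OF assms(1)] assms(2) by fastforce
qed

text \<open>Each of the \<open>k\<close> jumps costs \<open>q\<close> bits for an index and an entry
  of \<open>x\<close>. The other two bits are the parity of Alice's count and Bob's answer.\<close>

lemma rand_complexity_comp_XOR:
  assumes "n > 0" and f: "f \<in> cube n \<rightarrow> {-1, 1}" and sym: "symmetric n f"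
    and q: "4 * n \<le> 2 ^ q"
  defines "k \<equiv> odd_even_degree n f"
  shows "rand_complexity (1 / (2 * real n ^ k)) (cube n) (cube n) (comp_XOR f)
    \<le> enat (k * q + 2)"
proof -
  define D where "D = predicate n f"
  define I where "I = {i. i + 2 \<le> n \<and> D i \<noteq> D (i + 2)}"
  define ts where "ts = sorted_list_of_set I"
  define S where "S = {ms. set ms \<subseteq> {..<2 * n} \<and> length ms = k}"
  define B where "B = {..<2 * n} \<times> {-1, 1 :: int}"
  define dist where "dist x y = count_list (map2 (*) x y) (-1 :: int)" for x y
  define M where "M = (UNIV :: bool set) \<times> {zs. set zs \<subseteq> B \<and> length zs = k}"
  \<comment> \<open>For \<open>m \<ge> n\<close> there is no entry to send; the value 1 is a
    placeholder that \<open>vote\<close> ignores.\<close>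
  define msg where "msg x ms =
    (even (count_list x (-1)), map (\<lambda>m. (m, if m < n then x ! m else 1)) ms)"
    for x :: "int list" and ms :: "nat list"
  \<comment> \<open>Bob does not know the distance, but \<open>e\<close> is its evenness, and
    \<open>parity_sign\<close> may be evaluated at the representative 0 or 1 of the parity
    class.\<close>
  define V where "V p y = (let e = (fst p \<longleftrightarrow> even (count_list y (-1)))
    in parity_sign n I D (if e then 0 else 1) *
      prod_list (map2 (\<lambda>i (m, a). vote n (Suc i) (even i = e) m (a * (y ! m))) ts (snd p)))"
    for p :: "bool \<times> (nat \<times> int) list" and y :: "int list"
  have finI: "finite I" unfolding I_def by (rule finite_subset[of _ "{..n}"]) auto
  have k: "k = card I" by (simp add: k_def odd_even_degree_def I_def D_def)
  have len_ts: "length ts = k" and set_ts: "set ts = I" and ts: "distinct ts"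
    using finI by (simp_all add: ts_def k)
  have D: "D i \<in> {-1, 1}" if "i \<le> n" for i
    using predicate_sign[OF sym f that] by (simp add: D_def)
  have finS: "finite S" and cardS: "card S = (2 * n) ^ k"
    unfolding S_def by (simp_all add: finite_lists_length_eq card_lists_length_eq)
  have finB: "finite B" and cardB: "card B = 4 * n"
    by (simp_all add: B_def card_cartesian_product)
  have finM: "finite M"
    unfolding M_def using finB by (simp add: finite_lists_length_eq)
  have "card M = 2 * (4 * n) ^ k"
    unfolding M_def using finB cardB by (simp add: card_cartesian_product card_lists_length_eq)
  also have "\<dots> \<le> 2 * (2 ^ q) ^ k" using power_mono[OF q, of k] by simp
  also have "\<dots> = 2 ^ (k * q + 1)" by (simp add: mult.commute flip: power_mult)
  finally have cardM: "card M \<le> 2 ^ (k * q + 1)" .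
  have dist_le: "dist x y \<le> n" if "x \<in> cube n" "y \<in> cube n" for x y
    using map2_times_cube[OF that] count_le_length[of "map2 (*) x y" "-1"]
    by (simp only: dist_def cube_def mem_Collect_eq)
  have V_eq: "V (msg x ms) y = parity_sign n I D (dist x y) *
      prod_list (map2 (\<lambda>i m. vote n (Suc i) (even (i + dist x y)) m (map2 (*) x y ! m)) ts ms)"
    if x: "x \<in> cube n" and y: "y \<in> cube n" for x y ms
  proof -
    have par: "(even (count_list x (-1)) \<longleftrightarrow> even (count_list y (-1))) \<longleftrightarrow> even (dist x y)"
      using even_count_list_map2_times[of x y] x y by (simp add: dist_def cube_def)
    have mod: "parity_sign n I D (if even (dist x y) then 0 else 1) = parity_sign n I D (dist x y)"
      using parity_sign_mod_2[OF D I_def dist_le[OF x y]] by (simp add: mod_2_eq_odd)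
    have "vote n t e m ((if m < n then x ! m else 1) * (y ! m)) =
        vote n t e m (map2 (*) x y ! m)" for t e m
      using x y by (simp add: vote_def cube_def)
    then show ?thesis
      unfolding V_def msg_def Let_def fst_conv snd_conv par mod
      by (simp add: zip_map2 case_prod_unfold o_def)
  qed
  have V_sign: "V (msg x ms) y \<in> {-1, 1}" if x: "x \<in> cube n" and y: "y \<in> cube n" for x y ms
  proof -
    have mult: "a * b \<in> {-1, 1}" if "a \<in> {-1, 1}" "b \<in> {-1, 1}" for a b :: int
      using that by auto
    have list: "prod_list w \<in> {-1, 1}" if "set w \<subseteq> {-1, 1}" for w :: "int list"
      using that by (induction w) auto
    have map2: "set (map2 h ts ms) \<subseteq> {-1, 1}" if "\<And>i m. h i m \<in> {-1, 1}"
      for h :: "nat \<Rightarrow> nat \<Rightarrow> int"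
      using that by (simp add: image_subset_iff case_prod_unfold del: insert_iff)
    have factor: "sgn (factor n i c) \<in> {-1, 1}" for i c
      using abs_factor_ge[OF \<open>n > 0\<close>, of i c] by (auto simp: sgn_if)
    have "(\<Prod>i\<in>J. sgn (factor n i c)) \<in> {-1, 1}" for J c
    proof (induction J rule: infinite_finite_induct)
      case (insert i J)
      show ?case
        unfolding prod.insert[OF insert.hyps] by (rule mult[OF factor insert.IH])
    qed simp_all
    then have "parity_sign n I D (dist x y) \<in> {-1, 1}"
      unfolding parity_sign_def by (intro mult D dist_le x y)
    then show ?thesis
      unfolding V_eq[OF x y]
      by (rule mult[OF _ list[OF map2[OF vote_sign[OF map2_times_cube[OF x y]]]]])
  qed
  have bias: "real (card {ms\<in>S. V (msg x ms) y = comp_XOR f x y})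
      \<ge> (1/2 + 1 / (2 * real n ^ k)) * real (card S)"
    if x: "x \<in> cube n" and y: "y \<in> cube n" for x y
  proof -
    define z where "z = map2 (*) x y"
    define c where "c = count_list z (-1)"
    have z: "z \<in> cube n" using map2_times_cube[OF x y] by (simp add: z_def)
    have c: "dist x y = c" by (simp add: dist_def c_def z_def)
    then have "c \<le> n" using dist_le[OF x y] by simp
    have Dc: "comp_XOR f x y = D c" "D c \<in> {-1, 1}"
      using predicate_count[OF sym z] D[OF \<open>c \<le> n\<close>]
      by (simp_all add: comp_XOR_def D_def c_def z_def)
    have "(\<Sum>ms\<in>S. V (msg x ms) y) = parity_sign n I D c *
        (\<Sum>ms\<in>S. prod_list (map2 (\<lambda>i m. vote n (Suc i) (even (i + c)) m (z ! m)) ts ms))"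
      by (simp only: V_eq[OF x y] c z_def sum_distrib_left)
    also have "(\<Sum>ms\<in>S. prod_list (map2 (\<lambda>i m. vote n (Suc i) (even (i + c)) m (z ! m)) ts ms))
        = (\<Prod>i\<leftarrow>ts. \<Sum>m<2 * n. vote n (Suc i) (even (i + c)) m (z ! m))"
      unfolding S_def len_ts[symmetric] by (rule sum_lists_prod_list) simp
    also have "\<dots> = (\<Prod>i\<in>I. \<Sum>m<2 * n. vote n (Suc i) (even (i + c)) m (z ! m))"
      unfolding set_ts[symmetric] by (rule prod.distinct_set_conv_list[OF ts, symmetric])
    also have "\<dots> = (\<Prod>i\<in>I. factor n i c)"
      \<comment> \<open>The threshold \<open>Suc i\<close> is at most \<open>n\<close> because
        \<open>i + 2 \<le> n\<close> on \<open>I\<close>.\<close>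
      by (intro prod.cong refl, subst sum_vote[OF z]) (auto simp: I_def factor_def c_def)
    finally have "D c * (\<Sum>ms\<in>S. V (msg x ms) y) =
        (D c * D c) * ((\<Prod>i\<in>I. sgn (factor n i c)) * (\<Prod>i\<in>I. factor n i c))"
      by (simp add: parity_sign_def mult_ac)
    \<comment> \<open>\<open>D c\<close> squares to 1, and each factor times its own sign is its
      absolute value.\<close>
    also have "\<dots> = (\<Prod>i\<in>I. \<bar>factor n i c\<bar>)"
      using Dc(2) by (auto simp: abs_sgn mult.commute simp flip: prod.distrib)
    also have "\<dots> \<ge> (\<Prod>i\<in>I. 2)"
      by (rule prod_mono) (simp add: abs_factor_ge[OF \<open>n > 0\<close>])
    finally have "2 ^ k \<le> D c * (\<Sum>ms\<in>S. V (msg x ms) y)" by (simp add: k)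
    moreover have "2 * int (card {ms\<in>S. V (msg x ms) y = D c}) =
        int (card S) + D c * (\<Sum>ms\<in>S. V (msg x ms) y)"
      using V_sign[OF x y] by (intro card_agree_signs finS Dc(2)) auto
    ultimately have "int ((2 * n) ^ k) + 2 ^ k \<le> 2 * int (card {ms\<in>S. V (msg x ms) y = D c})"
      by (simp add: cardS)
    then have "real_of_int (int ((2 * n) ^ k) + 2 ^ k)
        \<le> real_of_int (2 * int (card {ms\<in>S. V (msg x ms) y = D c}))"
      by (simp only: of_int_le_iff)
    \<comment> \<open>The surplus \<open>2 ^ k\<close> over \<open>(2 * n) ^ k\<close> samples is
      what gives the bias \<open>1 / (2 * n ^ k)\<close>.\<close>
    moreover have "2 * ((1/2 + 1 / (2 * real n ^ k)) * real (card S)) =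
        real_of_int (int ((2 * n) ^ k) + 2 ^ k)"
      using \<open>n > 0\<close> by (simp add: cardS field_simps power_mult_distrib)
    ultimately show ?thesis by (simp add: Dc(1))
  qed
  have "msg x ms \<in> M" if "x \<in> cube n" "ms \<in> S" for x ms
  proof -
    have "x ! m \<in> {-1, 1}" if "m < n" for m
      using \<open>x \<in> cube n\<close> that nth_mem[of m x] unfolding cube_def by blast
    then have "(m, if m < n then x ! m else 1) \<in> B" if "m < 2 * n" for m
      using that unfolding B_def by simp
    then show ?thesis using that by (auto simp: M_def msg_def S_def)
  qed
  moreover have "S \<noteq> {}" using cardS \<open>n > 0\<close> by auto
  ultimately have "rand_complexity (1 / (2 * real n ^ k)) (cube n) (cube n) (comp_XOR f)
      \<le> enat (Suc (k * q + 1))"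
    by (intro rand_complexity_one_way[where msg = msg and V = V, OF finS _ finM cardM])
      (use V_sign bias in auto)
  then show ?thesis by simp
qed

section \<open>Choice of the bias and the final estimate\<close>

theorem mainTheorem10:
  "\<exists>C::real. C > 0 \<and>
     (\<forall>(n::nat) (k::nat) (f :: int list \<Rightarrow> int).
        n > 0 \<longrightarrow> even n \<longrightarrow>
        f \<in> cube n \<rightarrow> {-1, 1} \<longrightarrow>
        symmetric n f \<longrightarrow>
        odd_even_degree n f = k \<longrightarrow>
        PP (cube n) (cube n) (comp_XOR f) \<le> ereal (C * real (max 1 k) * log 2 (real n)))"
proof (intro exI[of _ 8] conjI allI impI)
  fix n k :: nat and f :: "int list \<Rightarrow> int"
  assume n: "n > 0" "even n" and f: "f \<in> cube n \<rightarrow> {-1, 1}" "symmetric n f"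
    and k: "odd_even_degree n f = k"
  define l where "l = log 2 (real n)"
  define q where "q = nat \<lceil>log 2 (real (4 * n))\<rceil>"
  define \<epsilon> where "\<epsilon> = 1 / (2 * real n ^ k)"
  have "n \<ge> 2" using n by (auto elim!: evenE)
  then have l: "l \<ge> 1" by (simp add: l_def le_log_iff)
  have log4n: "log 2 (real (4 * n)) = 2 + l"
    using n log_powr_cancel[of 2 2] by (simp add: log_mult l_def)
  \<comment> \<open>Rounding up gives \<open>q \<le> 3 + l\<close>, and \<open>l \<ge> 1\<close>
    absorbs the 3.\<close>
  have q_le: "real q \<le> 4 * l"
    using l unfolding q_def log4n by linarith
  have "log 2 (real (4 * n)) \<le> real q" unfolding q_def by linarith
  then have "real (4 * n) \<le> 2 powr real q" using n by (simp add: log_le_iff)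
  then have "real (4 * n) \<le> real (2 ^ q)" by (simp add: powr_realpow)
  then have q: "4 * n \<le> 2 ^ q" by (simp only: of_nat_le_iff)
  have log_eps: "log 2 (1 / \<epsilon>) = 1 + real k * l"
    using n by (simp add: \<epsilon>_def log_mult log_nat_power l_def)
  have "PP (cube n) (cube n) (comp_XOR f) \<le>
      ereal_of_enat (rand_complexity \<epsilon> (cube n) (cube n) (comp_XOR f)) + ereal (log 2 (1 / \<epsilon>))"
    unfolding PP_def using n by (intro INF_lower) (simp add: \<epsilon>_def)
  also have "\<dots> \<le> ereal_of_enat (enat (k * q + 2)) + ereal (1 + real k * l)"
    using rand_complexity_comp_XOR[OF n(1) f q] unfolding k \<epsilon>_def[symmetric] log_eps
    by (intro add_right_mono) (simp only: ereal_of_enat_le_iff)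
  also have "\<dots> = ereal (3 + real k * (real q + l))" by (simp add: algebra_simps)
  also have "\<dots> \<le> ereal (8 * real (max 1 k) * l)"
  proof -
    have "real k * (real q + l) \<le> real (max 1 k) * (5 * l)"
      using q_le l by (intro mult_mono) auto
    \<comment> \<open>This absorbs the additive 3, so that 5 + 3 gives the constant 8. The maximum
      with 1 covers \<open>k = 0\<close>, where a positive cost remains: the bias never exceeds 1/2,
      so its logarithmic term is at least 1.\<close>
    moreover have "1 * 1 \<le> real (max 1 k) * l" using l by (intro mult_mono) auto
    ultimately show ?thesis by (simp add: algebra_simps)
  qed
  finally show "PP (cube n) (cube n) (comp_XOR f) \<le>
      ereal (8 * real (max 1 k) * log 2 (real n))"
    by (simp add: l_def)
qed simp

end
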